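(* Let $n$ be a positive integer, let $a_1,\dots,a_n\in\mathbb{C}$, and let $A_n$ be the finite rank operator on $H^2(\mathbb{D})$ given by $A_n(f)=\sum_{i=1}^{n}\langle f,a_iz^i\rangle a_iz^i$ for $f\in H^2(\mathbb{D})$. Then the Berezin range $\mathrm{Ber}(A_n)$ is convex in $\mathbb{C}$.
   Context: $\mathbb{D}$ is the open unit disc in $\mathbb{C}$. $H^2(\mathbb{D})$ is the Hardy space of holomorphic functions $f(z)=\sum_{n\ge 0}a_nz^n$ on $\mathbb{D}$ with $\sum_{n\ge0}|a_n|^2<\infty$, with inner product $\langle f,g\rangle=\sum_{n\ge0}a_n\overline{b_n}$ for $g(z)=\sum_{n\ge 0} b_nz^n$. It is a reproducing kernel Hilbert space with reproducing kernel $k_\lambda(z)=\frac{1}{1-\bar\lambda z}$ at $\lambda\in\mathbb{D}$, and $\hat{k}_\lambda=k_\lambda/\|k_\lambda\|$ is the normalized reproducing kernel. $z^i$ denotes the function $z\mapsto z^i$. For a bounded linear operator $T$ on $H^2(\mathbb{D})$, the Berezin transform is $\widetilde{T}(\lambda)=\langle T\hat{k}_\lambda,\hat{k}_\lambda\rangle$ for $\lambda\in\mathbb{D}$, and the Berezin range is $\mathrm{Ber}(T)=\{\widetilde{T}(\lambda):\lambda\in\mathbb{D}\}$. *)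

theory Defs
  imports "HOL-Complex_Analysis.Complex_Analysis"
begin

text \<open>
  A function on the unit disc is represented by a total function on the complex plane whose values
  outside the open unit disc are irrelevant: membership in \<open>hardy_space\<close>, the inner product and the
  norm depend only on the restriction to the disc.
\<close>

definition taylor_coeff :: "(complex \<Rightarrow> complex) \<Rightarrow> nat \<Rightarrow> complex" where
  "taylor_coeff f n = fps_nth (fps_expansion f 0) n"

definition hardy_space :: "(complex \<Rightarrow> complex) set" where
  "hardy_space = {f. f holomorphic_on ball 0 1 \<and> summable (\<lambda>n. (cmod (taylor_coeff f n))\<^sup>2)}"

definition hardy_inner :: "(complex \<Rightarrow> complex) \<Rightarrow> (complex \<Rightarrow> complex) \<Rightarrow> complex" where
  "hardy_inner f g = (\<Sum>n. taylor_coeff f n * cnj (taylor_coeff g n))"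

definition hardy_norm :: "(complex \<Rightarrow> complex) \<Rightarrow> real" where
  "hardy_norm f = sqrt (Re (hardy_inner f f))"

definition rep_kernel :: "complex \<Rightarrow> complex \<Rightarrow> complex" where
  "rep_kernel l z = 1 / (1 - cnj l * z)"

definition normalized_kernel :: "complex \<Rightarrow> complex \<Rightarrow> complex" where
  "normalized_kernel l z = rep_kernel l z / of_real (hardy_norm (rep_kernel l))"

definition berezin_transform ::
  "((complex \<Rightarrow> complex) \<Rightarrow> (complex \<Rightarrow> complex)) \<Rightarrow> complex \<Rightarrow> complex" where
  "berezin_transform T l = hardy_inner (T (normalized_kernel l)) (normalized_kernel l)"

definition berezin_range ::
  "((complex \<Rightarrow> complex) \<Rightarrow> (complex \<Rightarrow> complex)) \<Rightarrow> complex set" where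
  "berezin_range T = berezin_transform T ` ball 0 1"

lemma taylor_coeff_eqI:
  "f has_fps_expansion F \<Longrightarrow> taylor_coeff f n = fps_nth F n"
  by (simp add: taylor_coeff_def fps_expansion_eqI)

lemma taylor_coeff_cong:
  assumes "\<And>z. z \<in> ball 0 1 \<Longrightarrow> f z = g z"
  shows "taylor_coeff f n = taylor_coeff g n"
proof -
  have "eventually (\<lambda>z. z \<in> ball 0 1) (nhds (0::complex))"
    by (rule eventually_nhds_in_open) auto
  then have "eventually (\<lambda>z. f z = g z) (nhds 0)"
    by (rule eventually_mono) (use assms in auto)
  then show ?thesis
    by (simp add: taylor_coeff_def fps_expansion_cong)
qed

lemma taylor_coeff_monomial:
  "taylor_coeff (\<lambda>z. c * z ^ i) n = (if n = i then c else 0)"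
proof -
  have "(\<lambda>z. c * z ^ i) has_fps_expansion fps_const c * fps_X ^ i"
    by (intro fps_expansion_intros)
  then have "taylor_coeff (\<lambda>z. c * z ^ i) n = fps_nth (fps_const c * fps_X ^ i) n"
    by (rule taylor_coeff_eqI)
  then show ?thesis by (simp add: fps_X_power_iff)
qed

lemma monomial_in_hardy_space: "(\<lambda>z. c * z ^ i) \<in> hardy_space"
proof -
  have "(\<lambda>n. (cmod (taylor_coeff (\<lambda>z. c * z ^ i) n))\<^sup>2) sums
      (\<Sum>n\<in>{i}. (cmod (taylor_coeff (\<lambda>z. c * z ^ i) n))\<^sup>2)"
    by (rule sums_finite) (auto simp: taylor_coeff_monomial)
  then show ?thesis
    by (auto simp: hardy_space_def sums_iff intro!: holomorphic_intros)
qed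

lemma rep_kernel_denom_nonzero:
  assumes "l \<in> ball 0 1" "z \<in> ball 0 1"
  shows "1 - cnj l * z \<noteq> 0"
proof
  assume "1 - cnj l * z = 0"
  then have "cmod (cnj l * z) = 1" by (metis eq_iff_diff_eq_0 norm_one)
  moreover have "cmod l * cmod z < 1 * 1"
    using assms by (intro mult_strict_mono') auto
  ultimately show False by (simp add: norm_mult)
qed

lemma taylor_coeff_rep_kernel: "taylor_coeff (rep_kernel l) n = cnj l ^ n"
proof -
  have "(\<lambda>z. 1 - cnj l * z) has_fps_expansion 1 - fps_const (cnj l) * fps_X"
    by (intro fps_expansion_intros)
  then have "(\<lambda>z. inverse (1 - cnj l * z)) has_fps_expansion
      inverse (1 - fps_const (cnj l) * fps_X)"
    by (rule has_fps_expansion_inverse) simp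
  moreover have "inverse (1 - fps_const (cnj l) * fps_X) = Abs_fps (\<lambda>n. cnj l ^ n)"
  proof (rule fps_inverse_unique)
    show "(1 - fps_const (cnj l) * fps_X) * Abs_fps (\<lambda>n. cnj l ^ n) = 1"
    proof (rule fps_ext)
      fix n
      show "fps_nth ((1 - fps_const (cnj l) * fps_X) * Abs_fps (\<lambda>n. cnj l ^ n)) n = fps_nth 1 n"
        by (cases n) (simp_all add: algebra_simps)
    qed
  qed
  ultimately show ?thesis
    using taylor_coeff_eqI[of "rep_kernel l"] by (simp add: rep_kernel_def[abs_def] divide_inverse)
qed

lemma rep_kernel_in_hardy_space:
  assumes "l \<in> ball 0 1"
  shows "rep_kernel l \<in> hardy_space"
proof -
  have "(cmod l)\<^sup>2 < 1" using assms by (simp add: power_less_one_iff abs_square_less_1)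
  then have "summable (\<lambda>n. ((cmod l)\<^sup>2) ^ n)" by (simp add: summable_geometric)
  then have "summable (\<lambda>n. (cmod (taylor_coeff (rep_kernel l) n))\<^sup>2)"
    by (simp add: taylor_coeff_rep_kernel norm_power power_mult[symmetric] mult.commute)
  moreover have "rep_kernel l holomorphic_on ball 0 1"
    unfolding rep_kernel_def[abs_def]
    by (intro holomorphic_intros) (use rep_kernel_denom_nonzero[OF assms] in auto)
  ultimately show ?thesis by (simp add: hardy_space_def)
qed

lemma rep_kernel_reproducing:
  assumes "f \<in> hardy_space" "l \<in> ball 0 1"
  shows "hardy_inner f (rep_kernel l) = f l"
proof -
  have "(\<lambda>n. (deriv ^^ n) f 0 / fact n * (l - 0) ^ n) sums f l"
    using assms by (intro holomorphic_power_series[where r = 1]) (auto simp: hardy_space_def)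
  then have "(\<lambda>n. taylor_coeff f n * l ^ n) sums f l"
    by (simp add: taylor_coeff_def fps_expansion_def)
  then show ?thesis
    by (simp add: hardy_inner_def taylor_coeff_rep_kernel sums_iff)
qed

end

theory Submission
  imports Defs
begin

text \<open>
  Pairing with \<open>w \<mapsto> a i * w ^ i\<close> only sees the \<open>i\<close>-th Taylor coefficient, so \<open>A\<close> acts on Taylor
  coefficients as the diagonal operator that multiplies the \<open>i\<close>-th one by \<open>(cmod (a i))\<^sup>2\<close> for
  \<open>1 \<le> i \<le> n\<close> and kills all others.  The \<open>i\<close>-th coefficient of the kernel at \<open>l\<close> is \<open>cnj l ^ i\<close>, and the
  squared norm of that kernel is \<open>1 / (1 - (cmod l)\<^sup>2)\<close>.  Hence the Berezin transform of \<open>A\<close> is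
  \<open>(1 - (cmod l)\<^sup>2) * (\<Sum>i=1..n. (cmod (a i))\<^sup>2 * (cmod l) ^ (2 * i))\<close>,
  a real number depending continuously on \<open>l\<close> (\<open>berezin_transform_diagonal\<close>).  The disc is connected,
  so the Berezin range is a connected set of real numbers, that is, an interval.
\<close>

lemma taylor_coeff_polynomial:
  assumes "finite I"
  shows "taylor_coeff (\<lambda>z. \<Sum>i\<in>I. c i * z ^ i) m = (if m \<in> I then c m else 0)"
proof -
  have "(\<lambda>z. \<Sum>i\<in>I. c i * z ^ i) has_fps_expansion (\<Sum>i\<in>I. fps_const (c i) * fps_X ^ i)"
    by (intro fps_expansion_intros)
  then have "taylor_coeff (\<lambda>z. \<Sum>i\<in>I. c i * z ^ i) m
      = fps_nth (\<Sum>i\<in>I. fps_const (c i) * fps_X ^ i) m"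
    by (rule taylor_coeff_eqI)
  also have "\<dots> = (\<Sum>i\<in>I. if m = i then c i else 0)"
    by (simp add: fps_sum_nth fps_X_power_iff if_distrib cong: if_cong)
  also have "\<dots> = (if m \<in> I then c m else 0)"
    using assms by simp
  finally show ?thesis .
qed

lemma taylor_coeff_divide:
  assumes "f holomorphic_on ball 0 1"
  shows "taylor_coeff (\<lambda>z. f z / c) m = taylor_coeff f m / c"
proof -
  have "f analytic_on {0}"
    using assms by (auto simp: analytic_at intro!: exI[of _ "ball 0 1"])
  then have "f has_fps_expansion fps_expansion f 0"
    by (rule analytic_at_imp_has_fps_expansion_0)
  then have "(\<lambda>z. inverse c * f z) has_fps_expansion fps_const (inverse c) * fps_expansion f 0"
    by (intro fps_expansion_intros)
  from taylor_coeff_eqI[OF this, of m] show ?thesis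
    by (simp add: taylor_coeff_def divide_inverse mult.commute)
qed

lemma hardy_inner_monomial:
  "hardy_inner f (\<lambda>w. c * w ^ i) = taylor_coeff f i * cnj c"
  unfolding hardy_inner_def
  by (subst suminf_finite[of "{i}"]) (auto simp: taylor_coeff_monomial)

lemma hardy_inner_polynomial:
  assumes "finite I" and "\<And>z. z \<in> ball 0 1 \<Longrightarrow> f z = (\<Sum>i\<in>I. c i * z ^ i)"
  shows "hardy_inner f g = (\<Sum>i\<in>I. c i * cnj (taylor_coeff g i))"
proof -
  have "taylor_coeff f m = (if m \<in> I then c m else 0)" for m
    using taylor_coeff_cong[OF assms(2)] taylor_coeff_polynomial[OF assms(1)] by simp
  then show ?thesis
    unfolding hardy_inner_def
    by (subst suminf_finite[OF assms(1)]) (auto intro!: sum.cong)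
qed

text \<open>The reproducing property turns the squared norm into the value of the kernel at \<open>l\<close> itself.\<close>

lemma hardy_norm_rep_kernel:
  assumes "l \<in> ball 0 1"
  shows "(hardy_norm (rep_kernel l))\<^sup>2 = 1 / (1 - (cmod l)\<^sup>2)"
proof -
  have "(cmod l)\<^sup>2 < 1"
    using assms by (simp add: abs_square_less_1)
  moreover have "rep_kernel l l = of_real (1 / (1 - (cmod l)\<^sup>2))"
    by (simp only: rep_kernel_def of_real_divide of_real_diff of_real_1 complex_norm_square mult.commute)
  then have "Re (rep_kernel l l) = 1 / (1 - (cmod l)\<^sup>2)"
    by (simp only: Re_complex_of_real)
  ultimately show ?thesis
    using rep_kernel_reproducing[OF rep_kernel_in_hardy_space[OF assms] assms]
    by (simp add: hardy_norm_def)
qed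

lemma taylor_coeff_normalized_kernel:
  assumes "l \<in> ball 0 1"
  shows "taylor_coeff (normalized_kernel l) m = cnj l ^ m / of_real (hardy_norm (rep_kernel l))"
  using rep_kernel_in_hardy_space[OF assms] taylor_coeff_divide[of "rep_kernel l"]
  by (simp add: normalized_kernel_def[abs_def] hardy_space_def taylor_coeff_rep_kernel)

lemma normalized_kernel_in_hardy_space:
  assumes "l \<in> ball 0 1"
  shows "normalized_kernel l \<in> hardy_space"
proof -
  let ?N = "hardy_norm (rep_kernel l)"
  have k: "rep_kernel l holomorphic_on ball 0 1"
    "summable (\<lambda>m. (cmod (taylor_coeff (rep_kernel l) m))\<^sup>2)"
    using rep_kernel_in_hardy_space[OF assms] by (auto simp: hardy_space_def)
  have "normalized_kernel l = (\<lambda>z. inverse (of_real ?N) * rep_kernel l z)"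
    by (simp add: normalized_kernel_def fun_eq_iff divide_inverse mult.commute)
  then have "normalized_kernel l holomorphic_on ball 0 1"
    using k(1) by (auto intro: holomorphic_intros)
  moreover have "(cmod (taylor_coeff (normalized_kernel l) m))\<^sup>2
      = (cmod (taylor_coeff (rep_kernel l) m))\<^sup>2 / ?N\<^sup>2" for m
    by (simp add: taylor_coeff_normalized_kernel[OF assms] taylor_coeff_rep_kernel
        norm_divide power_divide)
  ultimately show ?thesis
    using summable_divide[OF k(2), of "?N\<^sup>2"] by (simp add: hardy_space_def)
qed

lemma berezin_transform_diagonal:
  assumes "finite I"
    and A: "\<And>f z. f \<in> hardy_space \<Longrightarrow> z \<in> ball 0 1 \<Longrightarrow>
           A f z = (\<Sum>i\<in>I. hardy_inner f (\<lambda>w. a i * w ^ i) * (a i * z ^ i))"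
    and l: "l \<in> ball 0 1"
  shows "berezin_transform A l =
    of_real ((1 - (cmod l)\<^sup>2) * (\<Sum>i\<in>I. (cmod (a i))\<^sup>2 * (cmod l) ^ (2 * i)))"
proof -
  let ?h = "normalized_kernel l" and ?N = "hardy_norm (rep_kernel l)"
  have "A ?h z = (\<Sum>i\<in>I. taylor_coeff ?h i * cnj (a i) * a i * z ^ i)" if "z \<in> ball 0 1" for z
    using A[OF normalized_kernel_in_hardy_space[OF l] that]
    by (simp add: hardy_inner_monomial mult.assoc)
  from hardy_inner_polynomial[OF assms(1) this]
  have "berezin_transform A l
      = (\<Sum>i\<in>I. taylor_coeff ?h i * cnj (a i) * a i * cnj (taylor_coeff ?h i))"
    by (simp add: berezin_transform_def)
  also have "\<dots> = (\<Sum>i\<in>I. of_real ((cmod (a i))\<^sup>2 * (cmod (taylor_coeff ?h i))\<^sup>2))"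
    by (simp only: of_real_mult complex_norm_square mult_ac)
  also have "\<dots> = (\<Sum>i\<in>I. of_real ((1 / ?N\<^sup>2) * ((cmod (a i))\<^sup>2 * (cmod l) ^ (2 * i))))"
    by (simp add: taylor_coeff_normalized_kernel[OF l] norm_divide norm_power power_divide
        mult.commute flip: power_mult)
  also have "\<dots> = of_real ((1 - (cmod l)\<^sup>2) * (\<Sum>i\<in>I. (cmod (a i))\<^sup>2 * (cmod l) ^ (2 * i)))"
    by (simp only: hardy_norm_rep_kernel[OF l] of_real_sum sum_distrib_left) simp
  finally show ?thesis .
qed

text \<open>Connected sets of real numbers are intervals, and the embedding of the reals is linear.\<close>

lemma convex_of_real_image_connected:
  fixes g :: "'a :: topological_space \<Rightarrow> real"
  assumes "connected S" and "continuous_on S g"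
  shows "convex ((\<lambda>x. complex_of_real (g x)) ` S)"
proof -
  have "convex (g ` S)"
    using connected_continuous_image[OF assms(2,1)] by (metis is_interval_connected_1 is_interval_convex_1)
  then have "convex (complex_of_real ` g ` S)"
    by (rule convex_linear_image[OF bounded_linear.linear[OF bounded_linear_of_real]])
  then show ?thesis
    by (simp add: image_image)
qed

theorem theorem2p2:
  fixes n :: nat and a :: "nat \<Rightarrow> complex"
    and A :: "(complex \<Rightarrow> complex) \<Rightarrow> (complex \<Rightarrow> complex)"
  assumes "n \<ge> 1"
    and "\<And>f z. f \<in> hardy_space \<Longrightarrow> z \<in> ball 0 1 \<Longrightarrow>
           A f z = (\<Sum>i=1..n. hardy_inner f (\<lambda>w. a i * w ^ i) * (a i * z ^ i))"
  shows "convex (berezin_range A)"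
proof -
  let ?g = "\<lambda>l. (1 - (cmod l)\<^sup>2) * (\<Sum>i=1..n. (cmod (a i))\<^sup>2 * (cmod l) ^ (2 * i))"
  have "berezin_range A = (\<lambda>l. complex_of_real (?g l)) ` ball 0 1"
    unfolding berezin_range_def
    by (intro image_cong refl berezin_transform_diagonal assms(2)) auto
  moreover have "continuous_on (ball 0 1) ?g"
    by (intro continuous_intros)
  ultimately show ?thesis
    using convex_of_real_image_connected[OF connected_ball, of 0 1 ?g] by (simp only:)
qed

end
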